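(* There is a constant $c$ such that for every positive integer $n$ there exists a decision tree processing strings of length $n$ that has height at most $cn$ and finds all runs.
   Context: Strings are over a general totally ordered alphabet; $t[i..j]=t[i]\cdots t[j]$. An integer $q$ is a period of a string $w$ if $0<q<|w|$ and $w[i]=w[i+q]$ for $i=1,\ldots,|w|-q$; the minimal period is the least one. A run of a string $t$ is a substring $t[i..j]$ whose length is at least twice its minimal period, such that each of $t[i-1..j]$ and $t[i..j+1]$, whenever defined, has strictly greater minimal period than $t[i..j]$. A decision tree processing strings of length $n$ is a rooted ternary tree whose interior vertices are labeled with pairs $(i,j)$, $1\le i,j\le n$, with outgoing edges labeled $<,=,>$; a string $t$ of length $n$ reaches a vertex if along the path from the root every vertex labeled $(i,j)$ is left via the edge labeled by the actual relation between $t[i]$ and $t[j]$; each string reaches exactly one leaf. The height is the maximal number of edges on a root-to-leaf path. The tree finds all runs if for any strings $t_1,t_2$ of length $n$ reaching the same leaf and all $i,j\in\{1,\ldots,n\}$, $t_1[i..j]$ is a run of $t_1$ iff $t_2[i..j]$ is a run of $t_2$. *)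

theory Defs
  imports Main "HOL-Library.Extended_Nat"
begin

text \<open>Strings are lists; all positions are 1-based.\<close>

definition char_at :: "'a list \<Rightarrow> nat \<Rightarrow> 'a" where
  "char_at t i = t ! (i - 1)"

definition substring :: "'a list \<Rightarrow> nat \<Rightarrow> nat \<Rightarrow> 'a list" where
  "substring t i j = take (Suc j - i) (drop (i - 1) t)"

definition is_period :: "nat \<Rightarrow> 'a list \<Rightarrow> bool" where
  "is_period q w \<longleftrightarrow> 0 < q \<and> q < length w \<and>
     (\<forall>i\<in>{1..length w - q}. char_at w i = char_at w (i + q))"

text \<open>
  A string need not have any period, since a period is required to be smaller than
  the length. The minimal period is then infinite (the infimum of the empty set), so that
  such a string is never a run, and an extension without periods (as of aa to aab)
  counts as having a greater minimal period.
\<close>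

definition min_period :: "'a list \<Rightarrow> enat" where
  "min_period w = Inf {enat q | q. is_period q w}"

definition is_run :: "'a list \<Rightarrow> nat \<Rightarrow> nat \<Rightarrow> bool" where
  "is_run t i j \<longleftrightarrow> 1 \<le> i \<and> i \<le> j \<and> j \<le> length t \<and>
     2 * min_period (substring t i j) \<le> enat (length (substring t i j)) \<and>
     (1 < i \<longrightarrow> min_period (substring t i j) < min_period (substring t (i - 1) j)) \<and>
     (j < length t \<longrightarrow> min_period (substring t i j) < min_period (substring t i (j + 1)))"

datatype outcome = Lt | Eq | Gt

text \<open>The order \<open>r\<close> is the non-strict one, as in \<^const>\<open>linear_order_on\<close>.\<close>

definition compare_in :: "('a \<times> 'a) set \<Rightarrow> 'a \<Rightarrow> 'a \<Rightarrow> outcome" where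
  "compare_in r x y = (if x = y then Eq else if (x, y) \<in> r then Lt else Gt)"

text \<open>The subtrees of \<open>Query i j\<close> hang off the edges labelled Lt, Eq, Gt, in this order.\<close>

datatype dtree = Leaf | Query nat nat dtree dtree dtree

primrec child :: "dtree \<Rightarrow> dtree \<Rightarrow> dtree \<Rightarrow> outcome \<Rightarrow> dtree" where
  "child l e g Lt = l"
| "child l e g Eq = e"
| "child l e g Gt = g"

primrec processes :: "nat \<Rightarrow> dtree \<Rightarrow> bool" where
  "processes n Leaf \<longleftrightarrow> True"
| "processes n (Query i j l e g) \<longleftrightarrow> i \<in> {1..n} \<and> j \<in> {1..n} \<and>
     processes n l \<and> processes n e \<and> processes n g"

primrec height :: "dtree \<Rightarrow> nat" where
  "height Leaf = 0"
| "height (Query i j l e g) = Suc (max (height l) (max (height e) (height g)))"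

text \<open>A vertex is identified with the sequence of edge labels on its path from the root.\<close>

primrec leaves :: "dtree \<Rightarrow> outcome list set" where
  "leaves Leaf = {[]}"
| "leaves (Query i j l e g) =
     (#) Lt ` leaves l \<union> (#) Eq ` leaves e \<union> (#) Gt ` leaves g"

fun reaches :: "('a \<times> 'a) set \<Rightarrow> 'a list \<Rightarrow> dtree \<Rightarrow> outcome list \<Rightarrow> bool" where
  "reaches r t T [] \<longleftrightarrow> True"
| "reaches r t Leaf (a # v) \<longleftrightarrow> False"
| "reaches r t (Query i j l e g) (a # v) \<longleftrightarrow>
     a = compare_in r (char_at t i) (char_at t j) \<and> reaches r t (child l e g a) v"

definition strings :: "'a set \<Rightarrow> nat \<Rightarrow> 'a list set" where
  "strings A n = {t. set t \<subseteq> A \<and> length t = n}"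

definition finds_all_runs :: "'a set \<Rightarrow> ('a \<times> 'a) set \<Rightarrow> nat \<Rightarrow> dtree \<Rightarrow> bool" where
  "finds_all_runs A r n T \<longleftrightarrow>
     (\<forall>t1\<in>strings A n. \<forall>t2\<in>strings A n. \<forall>v\<in>leaves T.
        reaches r t1 T v \<and> reaches r t2 T v \<longrightarrow>
        (\<forall>i\<in>{1..n}. \<forall>j\<in>{1..n}. is_run t1 i j \<longleftrightarrow> is_run t2 i j))"

lemma reaches_some_leaf: "\<exists>v\<in>leaves T. reaches r t T v"
proof (induction T)
  case (Query i j l e g)
  then obtain x y z where "x \<in> leaves l" "reaches r t l x" "y \<in> leaves e" "reaches r t e y"
    "z \<in> leaves g" "reaches r t g z" by blast
  then show ?case
    by (intro bexI[of _ "case compare_in r (char_at t i) (char_at t j) of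
          Lt \<Rightarrow> Lt # x | Eq \<Rightarrow> Eq # y | Gt \<Rightarrow> Gt # z"]) (simp_all split: outcome.split)
qed simp

lemma reaches_unique_leaf:
  "\<lbrakk>u \<in> leaves T; reaches r t T u; v \<in> leaves T; reaches r t T v\<rbrakk> \<Longrightarrow> u = v"
proof (induction T arbitrary: u v)
  case (Query i j l e g)
  then show ?case by auto
qed simp

end

theory Submission imports Defs begin

text \<open>
  Only the unequal answers have to be counted: a query whose positions are already known to carry
  equal letters can be skipped, so that at most \<open>n - 1\<close> equal answers are ever received. Finding
  the first mismatch in a list of pairs of positions, e.g. a longest common extension, thus costs
  a single unequal answer, and it remains to find the runs with linearly many such searches.

  The runs are read off the next smaller suffixes (Bannai et al., The ``runs'' theorem). If a run
  with minimal period \<open>p\<close> is followed by a letter smaller than the one \<open>p\<close> positions before it, then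
  the next smaller suffix of the position \<open>a\<close> of its least rotation is the one at \<open>a + p\<close>;
  otherwise this holds for the reversed order. Conversely, if the next smaller suffix of \<open>a\<close> is the
  one at \<open>a + p\<close>, then the factor of length \<open>p\<close> at \<open>a\<close> is unbordered, so that \<open>p\<close> is the minimal
  period of the maximal extension of that factor with period \<open>p\<close>. The next smaller suffixes for an
  order are found with a stack by linearly many suffix comparisons, and two longest common
  extensions for every position then give the runs.
\<close>

section \<open>Runs by positions and explicit periods\<close>

definition periodic_on :: "(nat \<Rightarrow> 'b) \<Rightarrow> nat \<Rightarrow> nat \<Rightarrow> nat \<Rightarrow> bool" where
  "periodic_on s p i j \<longleftrightarrow> (\<forall>x. i \<le> x \<and> x + p \<le> j \<longrightarrow> s x = s (x + p))"

text \<open>The period is explicit, and maximality is a mismatch at distance \<open>p\<close> on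
  either side, so that every condition is an equality or inequality of two letters.\<close>

definition run_with_period :: "nat \<Rightarrow> (nat \<Rightarrow> 'b) \<Rightarrow> nat \<Rightarrow> nat \<Rightarrow> nat \<Rightarrow> bool" where
  "run_with_period n s i j p \<longleftrightarrow> 1 \<le> i \<and> i \<le> j \<and> j \<le> n \<and> 0 < p \<and> 2 * p \<le> Suc j - i \<and>
     periodic_on s p i j \<and> (\<forall>q. 0 < q \<and> q < p \<longrightarrow> \<not> periodic_on s q i j) \<and>
     (1 < i \<longrightarrow> s (i - 1) \<noteq> s (i - 1 + p)) \<and> (j < n \<longrightarrow> s (j + 1 - p) \<noteq> s (j + 1))"

text \<open>All letters involved lie inside the word and are only tested for equality. This permits
  replacing letters by their ranks.\<close>

lemma run_with_period_cong:
  assumes "\<And>x y. \<lbrakk>x \<in> {1..n}; y \<in> {1..n}\<rbrakk> \<Longrightarrow> s x = s y \<longleftrightarrow> s' x = s' y"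
  shows "run_with_period n s i j p \<longleftrightarrow> run_with_period n s' i j p"
proof -
  have per: "periodic_on s q i j \<longleftrightarrow> periodic_on s' q i j" if "1 \<le> i" "j \<le> n" for q
    unfolding periodic_on_def using that
    by (intro all_cong1 imp_cong refl assms) auto
  have left: "s (i - 1) = s (i - 1 + p) \<longleftrightarrow> s' (i - 1) = s' (i - 1 + p)"
    if "1 < i" "j \<le> n" "2 * p \<le> Suc j - i" "i \<le> j"
    using that by (intro assms) auto
  have right: "s (j + 1 - p) = s (j + 1) \<longleftrightarrow> s' (j + 1 - p) = s' (j + 1)"
    if "1 \<le> i" "i \<le> j" "j < n" "2 * p \<le> Suc j - i"
    using that by (intro assms) auto
  show ?thesis
    unfolding run_with_period_def using per left right by blast
qed

lemma is_period_substring: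
  assumes "1 \<le> i" "j \<le> length t"
  shows "is_period q (substring t i j) \<longleftrightarrow>
    0 < q \<and> q < Suc j - i \<and> periodic_on (char_at t) q i j"
proof -
  have len: "length (substring t i j) = Suc j - i"
    using assms by (auto simp: substring_def)
  have nth: "char_at (substring t i j) k = char_at t (i + k - 1)" if "1 \<le> k" "k \<le> Suc j - i" for k
    using that assms by (auto simp: substring_def char_at_def intro!: arg_cong[where f = "nth t"])
  have "(\<forall>k\<in>{1..Suc j - i - q}. char_at (substring t i j) k = char_at (substring t i j) (k + q)) \<longleftrightarrow>
    periodic_on (char_at t) q i j" if "0 < q" "q < Suc j - i"
  proof
    assume L: "\<forall>k\<in>{1..Suc j - i - q}. char_at (substring t i j) k = char_at (substring t i j) (k + q)"
    show "periodic_on (char_at t) q i j"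
      unfolding periodic_on_def
    proof (intro allI impI)
      fix x assume x: "i \<le> x \<and> x + q \<le> j"
      then have k: "Suc (x - i) \<in> {1..Suc j - i - q}" by auto
      have "char_at (substring t i j) (Suc (x - i)) = char_at t x"
        using nth[of "Suc (x - i)"] k x by simp
      moreover have "char_at (substring t i j) (Suc (x - i) + q) = char_at t (x + q)"
        using nth[of "Suc (x - i) + q"] k x by simp
      ultimately show "char_at t x = char_at t (x + q)" using L k by metis
    qed
  next
    assume R: "periodic_on (char_at t) q i j"
    show "\<forall>k\<in>{1..Suc j - i - q}. char_at (substring t i j) k = char_at (substring t i j) (k + q)"
    proof
      fix k assume k: "k \<in> {1..Suc j - i - q}"
      have "char_at t (i + k - 1) = char_at t (i + k - 1 + q)"
        by (rule R[unfolded periodic_on_def, rule_format]) (use k that in auto)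
      moreover have "1 \<le> k" "k \<le> Suc j - i" "1 \<le> k + q" "k + q \<le> Suc j - i"
        and "i + k - 1 + q = i + (k + q) - 1" using k that by auto
      ultimately show "char_at (substring t i j) k = char_at (substring t i j) (k + q)"
        using nth by metis
    qed
  qed
  then show ?thesis unfolding is_period_def len by blast
qed

lemma min_period_le: "is_period q w \<Longrightarrow> min_period w \<le> enat q"
  unfolding min_period_def by (auto intro: Inf_lower)

lemma min_period_attained:
  assumes "min_period w = enat p" shows "is_period p w"
proof -
  let ?S = "{enat q | q. is_period q w}"
  have Inf: "Inf ?S = enat p" using assms by (simp add: min_period_def)
  then have "?S \<noteq> {}" by (metis Inf_enat_def enat.distinct(1))
  then have "Inf ?S \<in> ?S"
    unfolding Inf_enat_def using LeastI_ex[of "\<lambda>x. x \<in> ?S"] by auto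
  then show ?thesis using Inf by auto
qed

lemma less_min_period_iff: "enat p < min_period w \<longleftrightarrow> (\<forall>q. is_period q w \<longrightarrow> p < q)"
proof
  assume "enat p < min_period w"
  then show "\<forall>q. is_period q w \<longrightarrow> p < q"
    using min_period_le by (metis enat_ord_simps(2) order_less_le_trans)
next
  assume a: "\<forall>q. is_period q w \<longrightarrow> p < q"
  show "enat p < min_period w"
  proof (cases "min_period w")
    case (enat q)
    then show ?thesis using a min_period_attained by auto
  qed simp
qed

text \<open>A period of a one-letter extension that is at most \<open>p\<close> restricts to the
  factor and so equals \<open>p\<close> by minimality. Hence the minimal period grows strictly
  exactly when the new letter differs from the one at distance \<open>p\<close>.\<close>

lemma is_run_iff: "is_run t i j \<longleftrightarrow> (\<exists>p. run_with_period (length t) (char_at t) i j p)"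
proof
  assume run: "is_run t i j"
  then have ij: "1 \<le> i" "i \<le> j" "j \<le> length t" by (auto simp: is_run_def)
  have len: "length (substring t i j) = Suc j - i"
    using ij by (auto simp: substring_def)
  have le: "2 * min_period (substring t i j) \<le> enat (Suc j - i)"
    using run len by (simp add: is_run_def)
  then obtain p where p: "min_period (substring t i j) = enat p"
    by (cases "min_period (substring t i j)") (auto simp: numeral_eq_enat)
  have p2: "2 * p \<le> Suc j - i" using le p by (simp add: numeral_eq_enat)
  have per: "0 < p" "p < Suc j - i" "periodic_on (char_at t) p i j"
    using min_period_attained[OF p] is_period_substring ij by blast+
  have min: "\<not> periodic_on (char_at t) q i j" if "0 < q" "q < p" for q
  proof
    assume "periodic_on (char_at t) q i j"
    then have "is_period q (substring t i j)"
      using is_period_substring[OF ij(1,3)] that per by simp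
    then show False using min_period_le p that by fastforce
  qed
  have left: "char_at t (i - 1) \<noteq> char_at t (i - 1 + p)" if i: "1 < i"
  proof
    assume eq: "char_at t (i - 1) = char_at t (i - 1 + p)"
    have "char_at t x = char_at t (x + p)" if "i - 1 \<le> x" "x + p \<le> j" for x
    proof (cases "x = i - 1")
      case False
      with that have "i \<le> x" by simp
      with that per(3) show ?thesis unfolding periodic_on_def by blast
    qed (use eq in simp)
    then have "periodic_on (char_at t) p (i - 1) j" by (simp add: periodic_on_def)
    then have "is_period p (substring t (i - 1) j)"
      using is_period_substring[of "i - 1" j t p] i ij per by auto
    moreover have "enat p < min_period (substring t (i - 1) j)"
      using run i p by (simp add: is_run_def)
    ultimately show False by (auto simp: less_min_period_iff)
  qed
  have right: "char_at t (j + 1 - p) \<noteq> char_at t (j + 1)" if j: "j < length t"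
  proof
    assume eq: "char_at t (j + 1 - p) = char_at t (j + 1)"
    have "char_at t x = char_at t (x + p)" if "i \<le> x" "x + p \<le> j + 1" for x
    proof (cases "x + p = j + 1")
      case True
      then have "x = j + 1 - p" by simp
      then show ?thesis using eq True by simp
    next
      case False
      with that have "x + p \<le> j" by simp
      with that per(3) show ?thesis unfolding periodic_on_def by blast
    qed
    then have "periodic_on (char_at t) p i (j + 1)" by (simp add: periodic_on_def)
    then have "is_period p (substring t i (j + 1))"
      using is_period_substring[of i "j + 1" t p] j ij per by auto
    moreover have "enat p < min_period (substring t i (j + 1))"
      using run j p by (simp add: is_run_def)
    ultimately show False by (auto simp: less_min_period_iff)
  qed
  show "\<exists>p. run_with_period (length t) (char_at t) i j p"
    unfolding run_with_period_def using ij p2 per min left right by blast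
next
  assume "\<exists>p. run_with_period (length t) (char_at t) i j p"
  then obtain p where ij: "1 \<le> i" "i \<le> j" "j \<le> length t"
    and p: "0 < p" "2 * p \<le> Suc j - i"
    and per: "periodic_on (char_at t) p i j"
    and min: "\<And>q. \<lbrakk>0 < q; q < p\<rbrakk> \<Longrightarrow> \<not> periodic_on (char_at t) q i j"
    and left: "1 < i \<Longrightarrow> char_at t (i - 1) \<noteq> char_at t (i - 1 + p)"
    and right: "j < length t \<Longrightarrow> char_at t (j + 1 - p) \<noteq> char_at t (j + 1)"
    unfolding run_with_period_def by blast
  have len: "length (substring t i j) = Suc j - i"
    using ij by (auto simp: substring_def)
  have "is_period p (substring t i j)"
    using is_period_substring[OF ij(1,3)] per p by auto
  moreover have "enat (p - 1) < min_period (substring t i j)"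
    unfolding less_min_period_iff using is_period_substring[OF ij(1,3)] min
    by (metis Suc_diff_1 linorder_not_less less_Suc_eq_le p(1))
  ultimately have mp: "min_period (substring t i j) = enat p"
    using min_period_le[of p "substring t i j"] min_period_attained p(1)
    by (cases "min_period (substring t i j)") auto
  have ext: "p < q" if "is_period q (substring t i' j')" "i' \<le> i" "j \<le> j'" "1 \<le> i'" "j' \<le> length t"
    "\<not> periodic_on (char_at t) p i' j'" for q i' j'
  proof (rule ccontr)
    assume q: "\<not> p < q"
    have *: "0 < q" "periodic_on (char_at t) q i' j'"
      using that(1) is_period_substring[OF that(4,5)] by auto
    then have "periodic_on (char_at t) q i j"
      using that(2,3) unfolding periodic_on_def by (meson order_trans)
    then have "q = p" using min q * by (meson linorder_neqE_nat)
    then show False using * that by simp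
  qed
  have "enat p < min_period (substring t (i - 1) j)" if "1 < i"
  proof -
    have "\<not> periodic_on (char_at t) p (i - 1) j"
      using left[OF that] p ij unfolding periodic_on_def by (auto intro!: exI[of _ "i - 1"])
    then show ?thesis unfolding less_min_period_iff using ext that ij by auto
  qed
  moreover have "enat p < min_period (substring t i (j + 1))" if "j < length t"
  proof -
    have "\<not> periodic_on (char_at t) p i (j + 1)"
      using right[OF that] p ij unfolding periodic_on_def by (auto intro!: exI[of _ "j + 1 - p"])
    then show ?thesis unfolding less_min_period_iff using ext that ij by auto
  qed
  ultimately show "is_run t i j"
    unfolding is_run_def mp len using ij p by (auto simp: numeral_eq_enat)
qed

section \<open>Identification with few unequal answers\<close>

text \<open>\<open>X\<close> holds the words consistent with the answers so far, and
  \<open>q\<close> bounds the unequal answers still to come before \<open>G\<close> is determined.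
  Equal answers are free here; they are paid for when the tree is built.\<close>

inductive identifiable ::
  "nat \<Rightarrow> ((nat \<Rightarrow> int) \<Rightarrow> 'b) \<Rightarrow> nat \<Rightarrow> (nat \<Rightarrow> int) set \<Rightarrow> bool" for n G where
  const: "(\<And>s s'. \<lbrakk>s \<in> X; s' \<in> X\<rbrakk> \<Longrightarrow> G s = G s') \<Longrightarrow> identifiable n G q X"
| query: "\<lbrakk>x \<in> {1..n}; y \<in> {1..n}; identifiable n G q {s \<in> X. s x < s y};
    identifiable n G (Suc q) {s \<in> X. s x = s y}; identifiable n G q {s \<in> X. s y < s x}\<rbrakk>
    \<Longrightarrow> identifiable n G (Suc q) X"

lemma identifiable_mono: "identifiable n G q X \<Longrightarrow> q \<le> q' \<Longrightarrow> identifiable n G q' X"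
proof (induction arbitrary: q' rule: identifiable.induct)
  case (query x y q X)
  then obtain q'' where "q' = Suc q''" "q \<le> q''" by (cases q') auto
  with query show ?case by (auto intro: identifiable.query)
qed (auto intro: identifiable.const)



text \<open>The answers up to and including the first unequal one: equal traces mean the same place
  and the same direction of the first mismatch.\<close>

primrec mismatch_trace :: "(nat \<Rightarrow> int) \<Rightarrow> (nat \<times> nat) list \<Rightarrow> bool option list" where
  "mismatch_trace s [] = []"
| "mismatch_trace s (xy # ps) =
    (if s (fst xy) = s (snd xy) then None # mismatch_trace s ps else [Some (s (fst xy) < s (snd xy))])"

lemma mismatch_trace_prefix:
  assumes "mismatch_trace s ps = mismatch_trace s' ps" "k \<le> length ps"
    "\<forall>m<k. s (fst (ps ! m)) = s (snd (ps ! m))"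
  shows "\<forall>m<k. s' (fst (ps ! m)) = s' (snd (ps ! m))"
  using assms
proof (induction ps arbitrary: k)
  case (Cons xy ps)
  show ?case
  proof (cases k)
    case (Suc k')
    have "s (fst xy) = s (snd xy)" using Cons.prems(3) Suc by (auto dest: spec[of _ 0])
    moreover from this have "s' (fst xy) = s' (snd xy)"
      using Cons.prems(1) by (auto split: if_splits)
    moreover have "\<forall>m<k'. s (fst (ps ! m)) = s (snd (ps ! m))"
      using Cons.prems(3) Suc by (metis Suc_less_eq nth_Cons_Suc)
    ultimately show ?thesis
      using Cons.IH[of k'] Cons.prems(1,2) Suc by (auto simp: less_Suc_eq_0_disj)
  qed simp
qed simp

lemma mismatch_trace_at:
  assumes "mismatch_trace s ps = mismatch_trace s' ps" "k < length ps"
    "\<forall>m<k. s (fst (ps ! m)) = s (snd (ps ! m))"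
  shows "(s (fst (ps ! k)) = s (snd (ps ! k)) \<longleftrightarrow> s' (fst (ps ! k)) = s' (snd (ps ! k))) \<and>
    (s (fst (ps ! k)) < s (snd (ps ! k)) \<longleftrightarrow> s' (fst (ps ! k)) < s' (snd (ps ! k)))"
  using assms
proof (induction ps arbitrary: k)
  case (Cons xy ps)
  show ?case
  proof (cases k)
    case 0
    then show ?thesis using Cons.prems(1) by (auto split: if_splits)
  next
    case (Suc k')
    have "s (fst xy) = s (snd xy)" using Cons.prems(3) Suc by (auto dest: spec[of _ 0])
    moreover from this have "s' (fst xy) = s' (snd xy)"
      using Cons.prems(1) by (auto split: if_splits)
    moreover have "\<forall>m<k'. s (fst (ps ! m)) = s (snd (ps ! m))"
      using Cons.prems(3) Suc by (metis Suc_less_eq nth_Cons_Suc)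
    ultimately show ?thesis
      using Cons.IH[of k'] Cons.prems(1,2) Suc by auto
  qed
qed simp

text \<open>The pairs are queried in order until an answer is unequal. The second premise is a
  continuation: it takes over for each class \<open>Y\<close> of words with a common trace.\<close>

lemma identifiable_first_mismatch:
  assumes "set ps \<subseteq> {1..n} \<times> {1..n}"
    and "\<And>Y. \<lbrakk>Y \<subseteq> X; \<And>s s'. \<lbrakk>s \<in> Y; s' \<in> Y\<rbrakk> \<Longrightarrow> mismatch_trace s ps = mismatch_trace s' ps\<rbrakk>
      \<Longrightarrow> identifiable n G q Y"
  shows "identifiable n G (Suc q) X"
  using assms
proof (induction ps arbitrary: X)
  case Nil
  then show ?case by (auto intro: identifiable_mono[of n G q])
next
  case (Cons xy ps)
  show ?case
  proof (rule identifiable.query)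
    show "fst xy \<in> {1..n}" "snd xy \<in> {1..n}" using Cons.prems(1) by auto
    \<comment> \<open>After an unequal answer the trace is a single entry, the same for all words
      left.\<close>
    show "identifiable n G q {s \<in> X. s (fst xy) < s (snd xy)}"
      by (rule Cons.prems(2)) auto
    show "identifiable n G q {s \<in> X. s (snd xy) < s (fst xy)}"
      by (rule Cons.prems(2)) auto
    show "identifiable n G (Suc q) {s \<in> X. s (fst xy) = s (snd xy)}"
    proof (rule Cons.IH)
      show "set ps \<subseteq> {1..n} \<times> {1..n}" using Cons.prems(1) by auto
      fix Y assume Y: "Y \<subseteq> {s \<in> X. s (fst xy) = s (snd xy)}"
        "\<And>s s'. \<lbrakk>s \<in> Y; s' \<in> Y\<rbrakk> \<Longrightarrow> mismatch_trace s ps = mismatch_trace s' ps"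
      show "identifiable n G q Y"
      proof (rule Cons.prems(2))
        show "Y \<subseteq> X" using Y(1) by blast
        fix s s' assume s: "s \<in> Y" "s' \<in> Y"
        then have "s (fst xy) = s (snd xy)" "s' (fst xy) = s' (snd xy)" using Y(1) by auto
        then show "mismatch_trace s (xy # ps) = mismatch_trace s' (xy # ps)"
          using Y(2)[OF s] by simp
      qed
    qed
  qed
qed

section \<open>Decision trees from identification\<close>

definition compare_int :: "int \<Rightarrow> int \<Rightarrow> outcome" where
  "compare_int x y = (if x = y then Eq else if x < y then Lt else Gt)"

primrec path :: "(nat \<Rightarrow> int) \<Rightarrow> dtree \<Rightarrow> outcome list" where
  "path s Leaf = []"
| "path s (Query x y l e g) = compare_int (s x) (s y) #
    (if s x = s y then path s e else if s x < s y then path s l else path s g)"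

lemma path_eqI:
  assumes "\<And>x y. \<lbrakk>x \<in> {1..n}; y \<in> {1..n}\<rbrakk> \<Longrightarrow>
      compare_in r (char_at t x) (char_at t y) = compare_int (s x) (s y)"
    and "processes n T" "v \<in> leaves T" "reaches r t T v"
  shows "v = path s T"
  using assms(2-)
proof (induction T arbitrary: v)
  case (Query x y l e g)
  have "compare_in r (char_at t x) (char_at t y) = compare_int (s x) (s y)"
    using Query.prems(1) by (intro assms(1)) auto
  with Query show ?case by (auto simp: compare_int_def split: if_splits)
qed simp

text \<open>Equal answers are charged to a union-find structure: \<open>f\<close> maps each position to the
  representative of its class, queries inside a class are skipped, and every equal answer to
  an actual query merges two classes.\<close>

lemma identifiable_imp_dtree:
  assumes "identifiable n G q X"
    and "\<And>s x y. \<lbrakk>s \<in> X; x \<in> {1..n}; y \<in> {1..n}; f x = f y\<rbrakk> \<Longrightarrow> s x = s y"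
  shows "\<exists>T. processes n T \<and> height T \<le> card (f ` {1..n}) + q \<and>
    (\<forall>s\<in>X. \<forall>s'\<in>X. path s T = path s' T \<longrightarrow> G s = G s')"
  using assms
proof (induction arbitrary: f rule: identifiable.induct)
  case (const X q)
  show ?case by (rule exI[of _ Leaf]) (auto intro: const)
next
  case (query x y q X)
  show ?case
  proof (cases "f x = f y")
    case True
    \<comment> \<open>The query would be answered equal by every word, so the tree of the equal
      branch already serves.\<close>
    then have "{s \<in> X. s x = s y} = X" using query by auto
    then show ?thesis using query.IH(2)[of f] query.prems by auto
  next
    case False
    \<comment> \<open>Renaming \<open>f y\<close> to \<open>f x\<close> removes a class, which pays
      for the edge of the equal answer; the other two edges are paid by \<open>q\<close>.\<close>
    define f' where "f' = (\<lambda>z. if f z = f y then f x else f z)"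
    have "f' ` {1..n} \<subseteq> f ` {1..n} - {f y}"
      using False query.hyps(1) by (auto simp: f'_def)
    then have "card (f' ` {1..n}) \<le> card (f ` {1..n} - {f y})" by (intro card_mono) auto
    moreover have "card (f ` {1..n}) = Suc (card (f ` {1..n} - {f y}))"
      using query.hyps(2) by (metis card.remove finite_atLeastAtMost finite_imageI imageI)
    ultimately have less: "Suc (card (f' ` {1..n})) \<le> card (f ` {1..n})" by simp
    obtain l where l: "processes n l" "height l \<le> card (f ` {1..n}) + q"
      "\<forall>s\<in>{s \<in> X. s x < s y}. \<forall>s'\<in>{s \<in> X. s x < s y}. path s l = path s' l \<longrightarrow> G s = G s'"
      using query.IH(1)[of f] query.prems by auto
    obtain g where g: "processes n g" "height g \<le> card (f ` {1..n}) + q"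
      "\<forall>s\<in>{s \<in> X. s y < s x}. \<forall>s'\<in>{s \<in> X. s y < s x}. path s g = path s' g \<longrightarrow> G s = G s'"
      using query.IH(3)[of f] query.prems by auto
    have merged: "s z = s w" if "s \<in> {s \<in> X. s x = s y}" "z \<in> {1..n}" "w \<in> {1..n}" "f' z = f' w" for s z w
    proof -
      have s: "s \<in> X" "s x = s y" using that by auto
      have *: "s a = s b" if "a \<in> {1..n}" "b \<in> {1..n}" "f a = f b" for a b
        using query.prems[OF s(1)] that by blast
      show ?thesis
        using that(2-) s(2) *[of z w] *[of z y] *[of z x] *[of w y] *[of w x] query.hyps(1,2)
        by (auto simp: f'_def split: if_splits)
    qed
    obtain e where e: "processes n e" "height e \<le> card (f' ` {1..n}) + Suc q"
      "\<forall>s\<in>{s \<in> X. s x = s y}. \<forall>s'\<in>{s \<in> X. s x = s y}. path s e = path s' e \<longrightarrow> G s = G s'"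
      using query.IH(2)[of f', OF merged] by blast
    show ?thesis
    proof (intro exI[of _ "Query x y l e g"] conjI ballI impI)
      show "processes n (Query x y l e g)" using query.hyps l e g by simp
      show "height (Query x y l e g) \<le> card (f ` {1..n}) + Suc q"
        using l(2) e(2) g(2) less by simp
      fix s s' assume s: "s \<in> X" "s' \<in> X"
        and path: "path s (Query x y l e g) = path s' (Query x y l e g)"
      consider "s x < s y" | "s x = s y" | "s y < s x" by linarith
      then show "G s = G s'"
      proof cases
        case 1
        then have "s' x < s' y" "path s l = path s' l"
          using path by (auto simp: compare_int_def split: if_splits)
        then show ?thesis using l(3) s 1 by blast
      next
        case 2
        then have "s' x = s' y" "path s e = path s' e"
          using path by (auto simp: compare_int_def split: if_splits)
        then show ?thesis using e(3) s 2 by blast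
      next
        case 3
        then have "s' y < s' x" "path s g = path s' g"
          using path by (auto simp: compare_int_def split: if_splits)
        then show ?thesis using g(3) s 3 by blast
      qed
    qed
  qed
qed

section \<open>Next smaller suffixes\<close>

text \<open>Lexicographic order of infinite words. The values beyond the end of a word decide when
  one suffix is a prefix of the other, and the definition also applies to rotations of a periodic
  word.\<close>

definition suffix_less :: "(nat \<Rightarrow> int) \<Rightarrow> nat \<Rightarrow> nat \<Rightarrow> bool" where
  "suffix_less u a b \<longleftrightarrow> (\<exists>k. (\<forall>m<k. u (a + m) = u (b + m)) \<and> u (a + k) < u (b + k))"

lemma suffix_less_irrefl: "\<not> suffix_less u a a"
  by (auto simp: suffix_less_def)

lemma suffix_less_trans:
  assumes "suffix_less u a b" "suffix_less u b c" shows "suffix_less u a c"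
proof -
  obtain k where k: "\<forall>m<k. u (a + m) = u (b + m)" "u (a + k) < u (b + k)"
    using assms(1) by (auto simp: suffix_less_def)
  obtain l where l: "\<forall>m<l. u (b + m) = u (c + m)" "u (b + l) < u (c + l)"
    using assms(2) by (auto simp: suffix_less_def)
  show ?thesis
    unfolding suffix_less_def
  proof (intro exI[of _ "min k l"] conjI allI impI)
    show "u (a + min k l) < u (c + min k l)"
      using k l by (cases k l rule: linorder_cases) (auto simp: min_def)
  qed (use k l in auto)
qed

lemma suffix_less_asym: "suffix_less u a b \<Longrightarrow> \<not> suffix_less u b a"
  using suffix_less_trans suffix_less_irrefl by blast

text \<open>Infinite suffixes at different positions may coincide, so a differing letter has to be
  supplied; the first one decides.\<close>

lemma suffix_less_total:
  assumes "u (a + k) \<noteq> u (b + k)" shows "suffix_less u a b \<or> suffix_less u b a"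
proof -
  obtain l where l: "u (a + l) \<noteq> u (b + l)" "\<forall>m<l. u (a + m) = u (b + m)"
    using exists_least_iff[of "\<lambda>k. u (a + k) \<noteq> u (b + k)"] assms by blast
  then show ?thesis unfolding suffix_less_def by (metis linorder_neqE_linordered_idom)
qed

lemma suffix_less_drop_prefix:
  assumes "suffix_less u a b" "\<forall>m<d. u (a + m) = u (b + m)"
  shows "suffix_less u (a + d) (b + d)"
proof -
  obtain k where k: "\<forall>m<k. u (a + m) = u (b + m)" "u (a + k) < u (b + k)"
    using assms(1) by (auto simp: suffix_less_def)
  with assms(2) have "d \<le> k" by (metis less_irrefl not_le_imp_less)
  with k show ?thesis
    unfolding suffix_less_def by (intro exI[of _ "k - d"]) (auto simp: add.assoc)
qed

text \<open>\<open>c = Suc n\<close> is the suffix that consists of padding only.\<close>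

definition next_smaller :: "nat \<Rightarrow> (nat \<Rightarrow> int) \<Rightarrow> nat \<Rightarrow> nat \<Rightarrow> bool" where
  "next_smaller n u a c \<longleftrightarrow> a < c \<and> c \<le> Suc n \<and> suffix_less u c a \<and>
     (\<forall>b. a < b \<and> b < c \<longrightarrow> suffix_less u a b)"

text \<open>A period \<open>q < p\<close> gives the factor at \<open>a\<close> a border of length
  \<open>p - q\<close>. Cutting it off the comparison of \<open>a\<close> with \<open>a + q\<close>
  makes the suffix at \<open>a + (p - q)\<close> smaller than the one at \<open>a + p\<close>, hence
  smaller than the one at \<open>a\<close>, although it lies before \<open>a + p\<close>.\<close>

lemma next_smaller_unbordered:
  assumes "next_smaller n u a (a + p)" "0 < q" "q < p" "i \<le> a" "a + p \<le> Suc j"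
  shows "\<not> periodic_on u q i j"
proof
  assume per: "periodic_on u q i j"
  have "suffix_less u a (a + q)" "suffix_less u a (a + (p - q))" "suffix_less u (a + p) a"
    using assms(1-3) by (auto simp: next_smaller_def)
  moreover have "\<forall>m<p - q. u (a + m) = u (a + q + m)"
  proof (intro allI impI)
    fix m assume "m < p - q"
    then have "i \<le> a + m \<and> a + m + q \<le> j" using assms by linarith
    then show "u (a + m) = u (a + q + m)"
      using per unfolding periodic_on_def by (metis add.assoc add.commute)
  qed
  ultimately have "suffix_less u (a + (p - q)) (a + q + (p - q))"
    using suffix_less_drop_prefix by blast
  then have "suffix_less u (a + (p - q)) (a + p)" using assms(3) by simp
  then show False
    using \<open>suffix_less u a (a + (p - q))\<close> \<open>suffix_less u (a + p) a\<close>
      suffix_less_trans suffix_less_asym by blast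
qed

text \<open>The witness is the least rotation of the root, i.e. its Lyndon conjugate.\<close>

lemma run_has_next_smaller:
  assumes "0 < p" "2 * p \<le> Suc j - i" "j \<le> n"
    and per: "periodic_on u p i j"
    and min: "\<And>q. \<lbrakk>0 < q; q < p\<rbrakk> \<Longrightarrow> \<not> periodic_on u q i j"
    and less: "u (j + 1) < u (j + 1 - p)"
  obtains a where "i \<le> a" "a < i + p" "next_smaller n u a (a + p)"
proof -
  \<comment> \<open>The root of the run repeated forever; its suffixes stand for the rotations of
    the root.\<close>
  define g where "g x = u (i + x mod p)" for x
  have g_p: "g (x + p) = g x" for x by (simp add: g_def)
  have g_mod: "g (b mod p + k) = g (b + k)" for b k by (simp add: g_def mod_add_left_eq)
  have g: "u (i + x) = g x" if "i + x \<le> j" for x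
    using that
  proof (induction x rule: less_induct)
    case (less x)
    show ?case
    proof (cases "x < p")
      case False
      then have "u (i + (x - p)) = u (i + (x - p) + p)"
        using per less.prems unfolding periodic_on_def by simp
      then show ?thesis using less.IH[of "x - p"] less.prems False assms(1) g_p[of "x - p"] by simp
    qed (simp add: g_def)
  qed
  obtain m where m: "m < p" "\<And>b. \<lbrakk>b < p; b \<noteq> m\<rbrakk> \<Longrightarrow> \<not> suffix_less g b m"
  proof -
    have "\<exists>m\<in>{..<p}. \<forall>x\<in>{..<p}. x \<noteq> m \<longrightarrow> \<not> suffix_less g x m"
    proof (rule Finite_Set.bex_min_element)
      show "asymp_on {..<p} (suffix_less g)" using suffix_less_asym by (intro asymp_onI)
      show "transp_on {..<p} (suffix_less g)" using suffix_less_trans by (intro transp_onI)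
    qed (use assms(1) in auto)
    then show ?thesis using that by auto
  qed
  have m_min: "\<not> suffix_less g b m" for b
  proof
    assume "suffix_less g b m"
    then have "suffix_less g (b mod p) m" by (simp add: suffix_less_def g_mod)
    then show False using m(2)[of "b mod p"] assms(1) suffix_less_irrefl by (metis mod_less_divisor)
  qed
  let ?a = "i + m"
  have below: "suffix_less u ?a (?a + d)" if d: "0 < d" "d < p" for d
  proof -
    \<comment> \<open>If the rotations at \<open>m\<close> and \<open>m + d\<close> coincided,
      \<open>g\<close> and with it the run would have period \<open>d < p\<close>.\<close>
    have "\<exists>k. g (m + k) \<noteq> g (m + d + k)"
    proof (rule ccontr)
      assume "\<nexists>k. g (m + k) \<noteq> g (m + d + k)"
      then have *: "g (m + k) = g (m + d + k)" for k by blast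
      have "g y = g (y + d)" for y
        using *[of "y + p - m"] g_p[of y] g_p[of "y + d"] m(1) by (simp add: algebra_simps)
      then have "u x = u (x + d)" if "i \<le> x" "x + d \<le> j" for x
        using g[of "x - i"] g[of "x - i + d"] that by (metis add.assoc le_add_diff_inverse add_leD1)
      then show False using min[OF d] by (simp add: periodic_on_def)
    qed
    then have gl: "suffix_less g m (m + d)" using suffix_less_total m_min by metis
    then obtain k where k: "\<forall>x<k. g (m + x) = g (m + d + x)" "g (m + k) < g (m + d + k)"
      by (auto simp: suffix_less_def)
    \<comment> \<open>Otherwise cutting \<open>p - d\<close> common letters would make the rotation
      at \<open>m + (p - d)\<close> smaller than the one at \<open>m + p\<close>, which is the least
      rotation. So the mismatch occurs before \<open>?a + p\<close>, inside the run, where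
      \<open>u\<close> and \<open>g\<close> agree.\<close>
    have "k < p - d"
    proof (rule ccontr)
      assume "\<not> k < p - d"
      then have "suffix_less g (m + (p - d)) (m + d + (p - d))"
        using suffix_less_drop_prefix[OF gl] k(1) by auto
      then have "suffix_less g (m + (p - d)) (m + p)" using d by simp
      moreover have "g (m + p + x) = g (m + x)" for x
        using g_p[of "m + x"] by (simp add: ac_simps)
      ultimately have "suffix_less g (m + (p - d)) m" by (simp add: suffix_less_def)
      then show False using m_min by blast
    qed
    then have g': "u (?a + x) = g (m + x)" "u (?a + d + x) = g (m + d + x)" if "x \<le> k" for x
      using that assms(2) m(1) d by (auto simp: add.assoc intro!: g)
    show ?thesis
      unfolding suffix_less_def using k g' by (intro exI[of _ k]) auto
  qed
  \<comment> \<open>The two suffixes agree up to the end of the run, and the letter after the run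
    decides.\<close>
  have "suffix_less u (?a + p) ?a"
    unfolding suffix_less_def
  proof (intro exI[of _ "j + 1 - p - ?a"] conjI allI impI)
    fix x assume "x < j + 1 - p - ?a"
    then have "i \<le> ?a + x \<and> ?a + x + p \<le> j" by linarith
    then have "u (?a + x) = u (?a + x + p)"
      using per unfolding periodic_on_def by blast
    then show "u (?a + p + x) = u (?a + x)" by (simp add: algebra_simps)
  next
    have "?a + p \<le> j + 1" using m(1) assms(2) by linarith
    then show "u (?a + p + (j + 1 - p - ?a)) < u (?a + (j + 1 - p - ?a))" using less by simp
  qed
  moreover have "suffix_less u ?a b" if "?a < b" "b < ?a + p" for b
    using below[of "b - ?a"] that by simp
  moreover have "?a + p \<le> Suc n" using m(1) assms(1-3) by linarith
  ultimately have "next_smaller n u ?a (?a + p)" using assms(1) by (auto simp: next_smaller_def)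
  then show ?thesis using that[of ?a] m(1) by simp
qed

section \<open>Scanning for the next smaller suffixes\<close>

text \<open>A word of length \<open>n\<close> is padded with zeros, which are smaller than its letters. Both the
  order and its reverse are covered by the words \<open>\<lambda>x. \<sigma> * s x\<close> for \<open>\<sigma> \<in> {1, -1}\<close>; in the
  reversed order the padding is larger than the letters.\<close>

definition padded_word :: "nat \<Rightarrow> (nat \<Rightarrow> int) \<Rightarrow> bool" where
  "padded_word n s \<longleftrightarrow> (\<forall>x\<in>{1..n}. 0 < s x) \<and> (\<forall>x>n. s x = 0)"

text \<open>The list ends when the second position reaches \<open>n\<close>, so the padding is never
  queried.\<close>

definition pairs_right :: "nat \<Rightarrow> nat \<Rightarrow> nat \<Rightarrow> (nat \<times> nat) list" where
  "pairs_right n a c = map (\<lambda>k. (a + k, c + k)) [0..<Suc n - c]"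

definition pairs_left :: "nat \<Rightarrow> nat \<Rightarrow> (nat \<times> nat) list" where
  "pairs_left a c = map (\<lambda>k. (a - 1 - k, c - 1 - k)) [0..<a - 1]"

lemma set_pairs_right: "\<lbrakk>1 \<le> a; a < c\<rbrakk> \<Longrightarrow> set (pairs_right n a c) \<subseteq> {1..n} \<times> {1..n}"
  by (auto simp: pairs_right_def)

lemma set_pairs_left: "\<lbrakk>a < c; c \<le> Suc n\<rbrakk> \<Longrightarrow> set (pairs_left a c) \<subseteq> {1..n} \<times> {1..n}"
  by (auto simp: pairs_left_def)

lemma pairs_right_nth [simp]:
  "k < Suc n - c \<Longrightarrow> pairs_right n a c ! k = (a + k, c + k)"
  "length (pairs_right n a c) = Suc n - c"
  by (auto simp: pairs_right_def simp del: upt_Suc)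

lemma pairs_left_nth [simp]:
  "k < a - 1 \<Longrightarrow> pairs_left a c ! k = (a - 1 - k, c - 1 - k)"
  "length (pairs_left a c) = a - 1"
  by (auto simp: pairs_left_def)

text \<open>When the suffix at \<open>c\<close> reaches the padding, the one at \<open>a\<close>
  still has a letter, which is nonzero.\<close>

lemma suffix_less_total_padded:
  assumes "padded_word n s" "\<sigma> \<in> {1, -1}" "1 \<le> a" "a < c" "c \<le> Suc n"
  shows "suffix_less (\<lambda>x. \<sigma> * s x) a c \<or> suffix_less (\<lambda>x. \<sigma> * s x) c a"
proof (rule suffix_less_total)
  have "a + (Suc n - c) \<in> {1..n}" "n < c + (Suc n - c)" using assms by auto
  then have "0 < s (a + (Suc n - c))" "s (c + (Suc n - c)) = 0"
    using assms(1) unfolding padded_word_def by blast+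
  then show "\<sigma> * s (a + (Suc n - c)) \<noteq> \<sigma> * s (c + (Suc n - c))" using assms(2) by auto
qed

text \<open>Either the first mismatch is recorded in the trace, or all pairs agree and a letter
  meets the padding, with the same outcome for both words.\<close>

lemma suffix_less_cong_trace:
  assumes s: "padded_word n s" "padded_word n s'" and "\<sigma> \<in> {1, -1}" "1 \<le> a" "a < c" "c \<le> Suc n"
    and trace: "mismatch_trace s (pairs_right n a c) = mismatch_trace s' (pairs_right n a c)"
    and less: "suffix_less (\<lambda>x. \<sigma> * s x) a c"
  shows "suffix_less (\<lambda>x. \<sigma> * s' x) a c"
proof -
  let ?N = "Suc n - c"
  have "a + ?N \<in> {1..n}" "n < c + ?N" using assms by auto
  then have pos: "0 < s (a + ?N)" "s (c + ?N) = 0" "0 < s' (a + ?N)" "s' (c + ?N) = 0"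
    using s unfolding padded_word_def by blast+
  obtain k where k: "\<forall>m<k. s (a + m) = s (c + m)" "\<sigma> * s (a + k) < \<sigma> * s (c + k)"
    using less assms(3) by (auto simp: suffix_less_def)
  have "k \<le> ?N" using k(1) pos(1,2) by (metis less_irrefl not_le_imp_less)
  then have pre: "\<forall>m<k. s' (a + m) = s' (c + m)"
    using mismatch_trace_prefix[OF trace, of k] k(1) by auto
  have "\<sigma> * s' (a + k) < \<sigma> * s' (c + k)"
  proof (cases "k = ?N")
    case True
    then show ?thesis using pos k(2) assms(3) by auto
  next
    case False
    with \<open>k \<le> ?N\<close> have "k < ?N" by simp
    then have "(s (a + k) = s (c + k) \<longleftrightarrow> s' (a + k) = s' (c + k)) \<and>
        (s (a + k) < s (c + k) \<longleftrightarrow> s' (a + k) < s' (c + k))"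
      using mismatch_trace_at[OF trace, of k] k(1) by auto
    then show ?thesis using k(2) assms(3) by auto
  qed
  then show ?thesis unfolding suffix_less_def using pre by auto
qed

section \<open>Recovering the runs\<close>

text \<open>An implication suffices, as it will hold for all ordered pairs of words in a class. It
  asks nothing at positions without a next smaller suffix, which occur for the reversed
  order.\<close>

definition same_extensions ::
  "nat \<Rightarrow> int \<Rightarrow> (nat \<Rightarrow> int) \<Rightarrow> (nat \<Rightarrow> int) \<Rightarrow> nat \<Rightarrow> bool" where
  "same_extensions n \<sigma> s s' a \<longleftrightarrow> (\<forall>c. next_smaller n (\<lambda>x. \<sigma> * s x) a c \<longrightarrow>
     next_smaller n (\<lambda>x. \<sigma> * s' x) a c \<and>
     mismatch_trace s (pairs_right n a c) = mismatch_trace s' (pairs_right n a c) \<and>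
     mismatch_trace s (pairs_left a c) = mismatch_trace s' (pairs_left a c))"

text \<open>The run contains a factor found by the scan for one of the two orders. The two traces at
  this factor reproduce the maximal extension with period \<open>p\<close>, and unborderedness makes
  \<open>p\<close> minimal in \<open>s'\<close> as well.\<close>

lemma run_with_period_transfer:
  assumes s: "padded_word n s" "padded_word n s'"
    and ext: "\<And>\<sigma> a. \<lbrakk>\<sigma> \<in> {1, -1}; a \<in> {1..n}\<rbrakk> \<Longrightarrow> same_extensions n \<sigma> s s' a"
    and run: "run_with_period n s i j p"
  shows "run_with_period n s' i j p"
proof -
  have ij: "1 \<le> i" "i \<le> j" "j \<le> n" "0 < p" "2 * p \<le> Suc j - i"
    and per: "periodic_on s p i j"
    and min: "\<And>q. \<lbrakk>0 < q; q < p\<rbrakk> \<Longrightarrow> \<not> periodic_on s q i j"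
    and left: "1 < i \<Longrightarrow> s (i - 1) \<noteq> s (i - 1 + p)"
    and right: "j < n \<Longrightarrow> s (j + 1 - p) \<noteq> s (j + 1)"
    using run unfolding run_with_period_def by blast+
  \<comment> \<open>At the end of the word the padding serves as the mismatching letter.\<close>
  have "s (j + 1 - p) \<noteq> s (j + 1)"
  proof (cases "j < n")
    case False
    then have "n < j + 1" "j + 1 - p \<in> {1..n}" using ij by auto
    then have "s (j + 1) = 0" "0 < s (j + 1 - p)" using s(1) unfolding padded_word_def by blast+
    then show ?thesis by simp
  qed (rule right)
  \<comment> \<open>The order is chosen so that the letter after the run is smaller than the one
    \<open>p\<close> before it.\<close>
  define \<sigma> :: int where "\<sigma> = (if s (j + 1) < s (j + 1 - p) then 1 else -1)"
  have \<sigma>: "\<sigma> \<in> {1, -1}" "\<sigma> \<noteq> 0" by (auto simp: \<sigma>_def)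
  have per_\<sigma>: "periodic_on (\<lambda>x. \<sigma> * w x) q x y \<longleftrightarrow> periodic_on w q x y" for w q x y
    using \<sigma>(2) by (simp add: periodic_on_def)
  obtain a where a: "i \<le> a" "a < i + p" "next_smaller n (\<lambda>x. \<sigma> * s x) a (a + p)"
  proof (rule run_has_next_smaller[of p j i n "\<lambda>x. \<sigma> * s x"])
    show "\<sigma> * s (j + 1) < \<sigma> * s (j + 1 - p)"
      using \<open>s (j + 1 - p) \<noteq> s (j + 1)\<close> by (auto simp: \<sigma>_def)
  qed (use ij per min in \<open>auto simp: per_\<sigma>\<close>)
  have apj: "a + p \<le> j" using a ij by linarith
  have "same_extensions n \<sigma> s s' a" using ext \<sigma>(1) a ij by auto
  then have ns: "next_smaller n (\<lambda>x. \<sigma> * s' x) a (a + p)"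
    and tr: "mismatch_trace s (pairs_right n a (a + p)) = mismatch_trace s' (pairs_right n a (a + p))"
    and tl: "mismatch_trace s (pairs_left a (a + p)) = mismatch_trace s' (pairs_left a (a + p))"
    using a(3) by (auto simp: same_extensions_def)
  have per_s: "s x = s (x + p)" if "i \<le> x" "x + p \<le> j" for x
    using per that by (simp add: periodic_on_def)
  \<comment> \<open>The indices of the mismatches that bound the run: the right pair there is
    \<open>(j + 1 - p, j + 1)\<close>, the left one \<open>(i - 1, i - 1 + p)\<close>.\<close>
  let ?k = "Suc j - (a + p)" and ?l = "a - i"
  have pre_r: "\<forall>m<?k. s (fst (pairs_right n a (a + p) ! m)) = s (snd (pairs_right n a (a + p) ! m))"
  proof (intro allI impI)
    fix m assume m: "m < ?k"
    then have "s (a + m) = s (a + m + p)" using a(1) by (intro per_s) auto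
    then show "s (fst (pairs_right n a (a + p) ! m)) = s (snd (pairs_right n a (a + p) ! m))"
      using m ij(3) by (simp add: ac_simps)
  qed
  have pre_l: "\<forall>m<?l. s (fst (pairs_left a (a + p) ! m)) = s (snd (pairs_left a (a + p) ! m))"
  proof (intro allI impI)
    fix m assume m: "m < ?l"
    then have "s (a - 1 - m) = s (a - 1 - m + p)" using apj by (intro per_s) auto
    moreover have "a - 1 - m + p = a + p - 1 - m" using m by simp
    ultimately show "s (fst (pairs_left a (a + p) ! m)) = s (snd (pairs_left a (a + p) ! m))"
      using m ij(1) by simp
  qed
  have r: "\<forall>m<?k. s' (fst (pairs_right n a (a + p) ! m)) = s' (snd (pairs_right n a (a + p) ! m))"
    using ij(3) by (intro mismatch_trace_prefix[OF tr _ pre_r]) auto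
  have l: "\<forall>m<?l. s' (fst (pairs_left a (a + p) ! m)) = s' (snd (pairs_left a (a + p) ! m))"
    using ij(1) by (intro mismatch_trace_prefix[OF tl _ pre_l]) auto
  have "periodic_on s' p i j"
    unfolding periodic_on_def
  proof (intro allI impI)
    fix x assume x: "i \<le> x \<and> x + p \<le> j"
    show "s' x = s' (x + p)"
    proof (cases "a \<le> x")
      case True
      then have "x - a < ?k" "x - a < Suc n - (a + p)" "a + (x - a) = x" "a + p + (x - a) = x + p"
        using x ij(3) by auto
      then show ?thesis using r[rule_format, of "x - a"] by (metis fst_conv pairs_right_nth(1) snd_conv)
    next
      case False
      then have "a - 1 - x < ?l" "a - 1 - x < a - 1" "a - 1 - (a - 1 - x) = x"
        "a + p - 1 - (a - 1 - x) = x + p" using x ij(1) by auto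
      then show ?thesis using l[rule_format, of "a - 1 - x"] by simp
    qed
  qed
  moreover have "\<not> periodic_on s' q i j" if "0 < q" "q < p" for q
    using next_smaller_unbordered[OF ns that a(1), of j] apj by (simp add: per_\<sigma>)
  moreover have "s' (i - 1) \<noteq> s' (i - 1 + p)" if "1 < i"
  proof -
    have "?l < a - 1" "a - 1 - ?l = i - 1" "a + p - 1 - ?l = i - 1 + p" using that a(1) by auto
    then show ?thesis
      using mismatch_trace_at[OF tl _ pre_l] left[OF that] by simp
  qed
  moreover have "s' (j + 1 - p) \<noteq> s' (j + 1)" if "j < n"
  proof -
    have "?k < Suc n - (a + p)" "a + ?k = j + 1 - p" "a + p + ?k = j + 1" using that apj by auto
    then show ?thesis
      using mismatch_trace_at[OF tr _ pre_r] right[OF that] by simp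
  qed
  ultimately show ?thesis using ij by (auto simp: run_with_period_def)
qed

section \<open>The stack scan\<close>

text \<open>The default lies just beyond \<open>Suc n\<close>, so that above an empty stack all
  later suffixes, including the padding, are known to be larger.\<close>

definition stack_top :: "nat \<Rightarrow> nat list \<Rightarrow> nat" where
  "stack_top n js = (case js of [] \<Rightarrow> n + 2 | j # _ \<Rightarrow> j)"

text \<open>The entry below \<open>a\<close> need not have a smaller suffix: the head may be a
  position still being compared with the stack.\<close>

primrec smaller_chain :: "nat \<Rightarrow> (nat \<Rightarrow> int) \<Rightarrow> nat list \<Rightarrow> bool" where
  "smaller_chain n u [] \<longleftrightarrow> True"
| "smaller_chain n u (a # js) \<longleftrightarrow> a < stack_top n js \<and> stack_top n js \<le> n + 2 \<and>
     (\<forall>b. a < b \<and> b < stack_top n js \<longrightarrow> suffix_less u a b) \<and> smaller_chain n u js"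

text \<open>The usual stack algorithm for next smaller values: a comparison of the suffixes at \<open>i\<close> and at
  the top of the stack either pops the stack or determines the entry of \<open>i\<close>. In the latter case
  one more query extends the pair to the left.\<close>

lemma identifiable_scan:
  assumes "\<sigma> \<in> {1, -1}" "\<And>s. s \<in> X \<Longrightarrow> padded_word n s" "i \<le> n"
    and "\<And>s. s \<in> X \<Longrightarrow> smaller_chain n (\<lambda>x. \<sigma> * s x) (i # js)"
    and "\<And>s s' a. \<lbrakk>s \<in> X; s' \<in> X; i < a; a \<le> n\<rbrakk> \<Longrightarrow> same_extensions n \<sigma> s s' a"
    and "\<And>Y. \<lbrakk>Y \<subseteq> X; \<And>s s' a. \<lbrakk>s \<in> Y; s' \<in> Y; a \<in> {1..n}\<rbrakk> \<Longrightarrow> same_extensions n \<sigma> s s' a\<rbrakk>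
      \<Longrightarrow> identifiable n G q Y"
  shows "identifiable n G (3 * i + length js + q) X"
  using assms(2-)
proof (induction "3 * i + length js" arbitrary: i js X rule: less_induct)
  \<comment> \<open>The potential pays for the searches. A pop lowers it by 1 and costs one
    comparison; settling \<open>i\<close> lowers it by 3, pushing \<open>i\<close> raises it by 1,
    and the difference covers the last comparison and the extension to the left.\<close>
  case less
  note padded = less.prems(1) and chain = less.prems(3) and known = less.prems(4)
    and finish = less.prems(5)
  show ?case
  proof (cases "i = 0")
    case True
    have "identifiable n G q X"
      by (rule finish) (use known True in auto)
    then show ?thesis by (rule identifiable_mono) simp
  next
    case i: False
    have known': "same_extensions n \<sigma> s s' a"
      if "Y \<subseteq> X" "\<And>s s'. \<lbrakk>s \<in> Y; s' \<in> Y\<rbrakk> \<Longrightarrow> same_extensions n \<sigma> s s' i"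
        "s \<in> Y" "s' \<in> Y" "i - 1 < a" "a \<le> n" for Y s s' a
    proof (cases "a = i")
      case False
      then have "i < a" using that(5) by simp
      then show ?thesis using known[of s s' a] that by blast
    qed (use that in simp)
    have chain': "smaller_chain n (\<lambda>x. \<sigma> * s x) ((i - 1) # i # js)" if "s \<in> X" for s
    proof -
      have "stack_top n (i # js) = i" by (simp add: stack_top_def)
      moreover have "i - 1 < i" "i \<le> n + 2" "\<forall>b. \<not> (i - 1 < b \<and> b < i)"
        using i less.prems(2) by auto
      ultimately show ?thesis
        using chain[OF that] unfolding smaller_chain.simps(2)[of n _ "i - 1"] by metis
    qed
    show ?thesis
    proof (cases js)
      case Nil
      \<comment> \<open>With an empty stack \<open>i\<close> has no next smaller suffix, and nothing
        is queried.\<close>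
      have "same_extensions n \<sigma> s s' i" if "s \<in> X" "s' \<in> X" for s s'
      proof -
        have "\<not> next_smaller n (\<lambda>x. \<sigma> * s x) i c" for c
        proof
          assume c: "next_smaller n (\<lambda>x. \<sigma> * s x) i c"
          then have "i < c" "c < n + 2" "suffix_less (\<lambda>x. \<sigma> * s x) c i"
            unfolding next_smaller_def by linarith+
          moreover have "\<forall>b. i < b \<and> b < n + 2 \<longrightarrow> suffix_less (\<lambda>x. \<sigma> * s x) i b"
            using chain[OF that(1)] unfolding Nil smaller_chain.simps stack_top_def list.case by blast
          ultimately show False using suffix_less_asym by blast
        qed
        then show ?thesis by (simp add: same_extensions_def)
      qed
      note ext = this
      have "identifiable n G (3 * (i - 1) + length [i] + q) X"
      proof (rule less.hyps)
        show "3 * (i - 1) + length [i] < 3 * i + length js" using i Nil by simp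
        show "i - 1 \<le> n" using less.prems(2) by simp
        show "smaller_chain n (\<lambda>x. \<sigma> * s x) ((i - 1) # [i])" if "s \<in> X" for s
          using chain'[OF that] Nil by simp
        show "same_extensions n \<sigma> s s' a" if "s \<in> X" "s' \<in> X" "i - 1 < a" "a \<le> n" for s s' a
          using known'[OF subset_refl ext that] .
      qed (use padded finish in blast)+
      then show ?thesis by (rule identifiable_mono) (use i Nil in simp)
    next
      case (Cons j rest)
      have "identifiable n G (Suc (3 * i + length rest + q)) X"
      proof (cases "X = {}")
        case True
        then show ?thesis by (auto intro: identifiable.const)
      next
        case False
        \<comment> \<open>The order of the stack entries is read off an arbitrary word of
          \<open>X\<close>, which is why empty \<open>X\<close> is treated apart.\<close>
        then obtain s where "smaller_chain n (\<lambda>x. \<sigma> * s x) (i # j # rest)"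
          using chain Cons by blast
        then have "i < stack_top n (j # rest)" "j < stack_top n rest" "stack_top n rest \<le> n + 2"
          unfolding smaller_chain.simps by blast+
        then have ij: "i < j" "j \<le> Suc n" by (simp_all add: stack_top_def)
        show ?thesis
        proof (rule identifiable_first_mismatch[where ps = "pairs_right n i j"])
          show "set (pairs_right n i j) \<subseteq> {1..n} \<times> {1..n}" using set_pairs_right i ij by simp
          fix Y assume Y: "Y \<subseteq> X" and trace: "\<And>s s'. \<lbrakk>s \<in> Y; s' \<in> Y\<rbrakk> \<Longrightarrow>
            mismatch_trace s (pairs_right n i j) = mismatch_trace s' (pairs_right n i j)"
          have agree: "suffix_less (\<lambda>x. \<sigma> * s' x) i j"
            if "s \<in> Y" "s' \<in> Y" "suffix_less (\<lambda>x. \<sigma> * s x) i j" for s s'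
            by (rule suffix_less_cong_trace[OF _ _ assms(1) _ ij(1,2) trace[OF that(1,2)] that(3)])
              (use that padded Y i in auto)
          show "identifiable n G (3 * i + length rest + q) Y"
          proof (cases "\<exists>s\<in>Y. suffix_less (\<lambda>x. \<sigma> * s x) i j")
            case True
            \<comment> \<open>All words of \<open>Y\<close> agree on the comparison. By transitivity
              the suffix at \<open>i\<close> is below those between \<open>j\<close> and the next
              entry too, so \<open>j\<close> is popped.\<close>
            then have lt: "suffix_less (\<lambda>x. \<sigma> * s x) i j" if "s \<in> Y" for s
              using agree that by blast
            show ?thesis
            proof (rule less.hyps)
              show "3 * i + length rest < 3 * i + length js" using Cons by simp
              show "smaller_chain n (\<lambda>x. \<sigma> * s x) (i # rest)" if s: "s \<in> Y" for s
              proof -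
                have "smaller_chain n (\<lambda>x. \<sigma> * s x) (i # j # rest)"
                  using chain s Y Cons by blast
                then have c: "\<forall>b. i < b \<and> b < j \<longrightarrow> suffix_less (\<lambda>x. \<sigma> * s x) i b"
                  "\<forall>b. j < b \<and> b < stack_top n rest \<longrightarrow> suffix_less (\<lambda>x. \<sigma> * s x) j b"
                  "j < stack_top n rest" "stack_top n rest \<le> n + 2"
                  "smaller_chain n (\<lambda>x. \<sigma> * s x) rest"
                  unfolding smaller_chain.simps by (simp_all add: stack_top_def)
                have "suffix_less (\<lambda>x. \<sigma> * s x) i b" if "i < b" "b < stack_top n rest" for b
                proof (cases b j rule: linorder_cases)
                  case greater
                  then show ?thesis using c(2) that suffix_less_trans[OF lt[OF s]] by blast
                qed (use c(1) that lt[OF s] in auto)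
                moreover have "i < stack_top n rest" using ij(1) c(3) by simp
                ultimately show ?thesis unfolding smaller_chain.simps using c(4,5) by blast
              qed
              show "same_extensions n \<sigma> s s' a" if "s \<in> Y" "s' \<in> Y" "i < a" "a \<le> n" for s s' a
                using known that Y by blast
            qed (use padded finish Y less.prems(2) in blast)+
          next
            case F: False
            have gt: "next_smaller n (\<lambda>x. \<sigma> * s x) i c \<longleftrightarrow> c = j" if s: "s \<in> Y" for s c
            proof -
              \<comment> \<open>The padding excludes equal suffixes, so the one at \<open>j\<close>
                is smaller, and it is the first such by the chain.\<close>
              have ji: "suffix_less (\<lambda>x. \<sigma> * s x) j i"
                using suffix_less_total_padded[OF _ assms(1) _ ij, of s] padded s Y F i by auto
              have below: "suffix_less (\<lambda>x. \<sigma> * s x) i b" if "i < b" "b < j" for b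
              proof -
                have "smaller_chain n (\<lambda>x. \<sigma> * s x) (i # j # rest)"
                  using chain s Y Cons by blast
                then have "\<forall>b. i < b \<and> b < stack_top n (j # rest) \<longrightarrow> suffix_less (\<lambda>x. \<sigma> * s x) i b"
                  unfolding smaller_chain.simps by blast
                then show ?thesis using that by (simp add: stack_top_def)
              qed
              show ?thesis
                using ji below suffix_less_asym ij unfolding next_smaller_def
                by (metis linorder_neqE_nat)
            qed
            have "identifiable n G (Suc (3 * (i - 1) + length (i # js) + q)) Y"
            proof (rule identifiable_first_mismatch[where ps = "pairs_left i j"])
              show "set (pairs_left i j) \<subseteq> {1..n} \<times> {1..n}" using set_pairs_left ij by simp
              fix Z assume Z: "Z \<subseteq> Y" and trace': "\<And>s s'. \<lbrakk>s \<in> Z; s' \<in> Z\<rbrakk> \<Longrightarrow>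
                mismatch_trace s (pairs_left i j) = mismatch_trace s' (pairs_left i j)"
              have ZX: "Z \<subseteq> X" using Z Y by blast
              have ext: "same_extensions n \<sigma> s s' i" if "s \<in> Z" "s' \<in> Z" for s s'
              proof -
                have sY: "s \<in> Y" "s' \<in> Y" using that Z by auto
                show ?thesis
                  unfolding same_extensions_def gt[OF sY(1)] gt[OF sY(2)]
                  using trace[OF sY] trace'[OF that] by simp
              qed
              show "identifiable n G (3 * (i - 1) + length (i # js) + q) Z"
              proof (rule less.hyps)
                show "3 * (i - 1) + length (i # js) < 3 * i + length js" using i by simp
                show "i - 1 \<le> n" using less.prems(2) by simp
                show "smaller_chain n (\<lambda>x. \<sigma> * s x) ((i - 1) # i # js)" if "s \<in> Z" for s
                  using chain' that ZX by blast
                show "same_extensions n \<sigma> s s' a" if "s \<in> Z" "s' \<in> Z" "i - 1 < a" "a \<le> n" for s s' a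
                  using known'[OF ZX ext that] .
              qed (use padded finish ZX in blast)+
            qed
            then show ?thesis by (rule identifiable_mono) (use i Cons in simp)
          qed
        qed
      qed
      then show ?thesis using Cons by simp
    qed
  qed
qed

lemma identifiable_next_smaller:
  assumes "\<sigma> \<in> {1, -1}" "\<And>s. s \<in> X \<Longrightarrow> padded_word n s"
    and "\<And>Y. \<lbrakk>Y \<subseteq> X; \<And>s s' a. \<lbrakk>s \<in> Y; s' \<in> Y; a \<in> {1..n}\<rbrakk> \<Longrightarrow> same_extensions n \<sigma> s s' a\<rbrakk>
      \<Longrightarrow> identifiable n G q Y"
  shows "identifiable n G (3 * n + 1 + q) X"
proof -
  \<comment> \<open>The stack starts with the suffix of padding only, which accounts for the added
    1.\<close>
  have "identifiable n G (3 * n + length [Suc n] + q) X"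
    by (rule identifiable_scan[OF assms(1,2) _ _ _ assms(3)]) (auto simp: stack_top_def)
  then show ?thesis by simp
qed

text \<open>One scan for each order, with the second as the continuation of the first.\<close>

lemma identifiable_runs:
  "identifiable n (\<lambda>s. {(i, j). \<exists>p. run_with_period n s i j p}) (6 * n + 2) {s. padded_word n s}"
  (is "identifiable n ?G _ ?X")
proof -
  have "identifiable n ?G (3 * n + 1 + (3 * n + 1 + 0)) ?X"
  proof (rule identifiable_next_smaller[of 1])
    fix Y assume Y: "Y \<subseteq> ?X"
      and ext1: "\<And>s s' a. \<lbrakk>s \<in> Y; s' \<in> Y; a \<in> {1..n}\<rbrakk> \<Longrightarrow> same_extensions n 1 s s' a"
    show "identifiable n ?G (3 * n + 1 + 0) Y"
    proof (rule identifiable_next_smaller[of "-1"])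
      fix Z assume Z: "Z \<subseteq> Y"
        and ext2: "\<And>s s' a. \<lbrakk>s \<in> Z; s' \<in> Z; a \<in> {1..n}\<rbrakk> \<Longrightarrow> same_extensions n (-1) s s' a"
      have "run_with_period n s' i j p"
        if "s \<in> Z" "s' \<in> Z" "run_with_period n s i j p" for s s' i j p
      proof (rule run_with_period_transfer[OF _ _ _ that(3)])
        show "padded_word n s" "padded_word n s'" using that Y Z by auto
        show "same_extensions n \<sigma> s s' a" if "\<sigma> \<in> {1, -1}" "a \<in> {1..n}" for \<sigma> a
          using that ext1[of s s' a] ext2[of s s' a] \<open>s \<in> Z\<close> \<open>s' \<in> Z\<close> Z by blast
      qed
      then show "identifiable n ?G 0 Z" by (intro identifiable.const) blast
    qed (use Y in auto)
  qed auto
  then show ?thesis by simp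
qed

section \<open>From arbitrary alphabets to integers\<close>

text \<open>Each letter counts itself, so ranks are positive and the padding stays below
  them.\<close>

definition rank_word :: "('a \<times> 'a) set \<Rightarrow> 'a list \<Rightarrow> nat \<Rightarrow> int" where
  "rank_word r t x =
    (if x \<in> {1..length t} then int (card {y \<in> set t. (y, char_at t x) \<in> r}) else 0)"

lemma char_at_in_set: "x \<in> {1..length t} \<Longrightarrow> char_at t x \<in> set t"
  by (auto simp: char_at_def)

lemma padded_rank_word:
  assumes "linear_order_on A r" "set t \<subseteq> A"
  shows "padded_word (length t) (rank_word r t)"
proof -
  have "0 < card {y \<in> set t. (y, char_at t x) \<in> r}" if "x \<in> {1..length t}" for x
  proof -
    have "char_at t x \<in> {y \<in> set t. (y, char_at t x) \<in> r}"
      using char_at_in_set[OF that] assms by (auto simp: order_on_defs refl_on_def)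
    then show ?thesis by (auto simp: card_gt_0_iff)
  qed
  then show ?thesis by (auto simp: padded_word_def rank_word_def)
qed

lemma compare_rank_word:
  assumes "linear_order_on A r" "set t \<subseteq> A" "x \<in> {1..length t}" "y \<in> {1..length t}"
  shows "compare_in r (char_at t x) (char_at t y) = compare_int (rank_word r t x) (rank_word r t y)"
proof -
  have less: "rank_word r t x < rank_word r t y"
    if xy: "x \<in> {1..length t}" "y \<in> {1..length t}" "(char_at t x, char_at t y) \<in> r"
      "char_at t x \<noteq> char_at t y" for x y
  proof -
    have "char_at t y \<in> {z \<in> set t. (z, char_at t y) \<in> r} - {z \<in> set t. (z, char_at t x) \<in> r}"
      using xy char_at_in_set[OF xy(2)] assms
      by (auto simp: order_on_defs refl_on_def antisym_def)
    moreover have "{z \<in> set t. (z, char_at t x) \<in> r} \<subseteq> {z \<in> set t. (z, char_at t y) \<in> r}"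
      using xy assms by (auto simp: order_on_defs trans_def)
    ultimately have "{z \<in> set t. (z, char_at t x) \<in> r} \<subset> {z \<in> set t. (z, char_at t y) \<in> r}"
      by blast
    then show ?thesis using xy by (simp add: rank_word_def psubset_card_mono)
  qed
  consider "char_at t x = char_at t y"
    | "char_at t x \<noteq> char_at t y" "(char_at t x, char_at t y) \<in> r"
    | "char_at t x \<noteq> char_at t y" "(char_at t y, char_at t x) \<in> r" "(char_at t x, char_at t y) \<notin> r"
    using char_at_in_set[OF assms(3)] char_at_in_set[OF assms(4)] assms(1,2)
    unfolding order_on_defs total_on_def by blast
  then show ?thesis
  proof cases
    case 1
    then show ?thesis using assms(3,4) by (simp add: compare_in_def compare_int_def rank_word_def)
  next
    case 2
    then show ?thesis using less[of x y] assms(3,4) by (simp add: compare_in_def compare_int_def)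
  next
    case 3
    then show ?thesis using less[of y x] assms(3,4) by (simp add: compare_in_def compare_int_def)
  qed
qed

theorem theorem11:
  "\<exists>c::nat. \<forall>n::nat. 0 < n \<longrightarrow>
     (\<exists>T. processes n T \<and> height T \<le> c * n \<and>
       (\<forall>(A::'a set) r. linear_order_on A r \<longrightarrow> finds_all_runs A r n T))"
proof (intro exI[of _ 9] allI impI)
  fix n :: nat assume n: "0 < n"
  let ?G = "\<lambda>s :: nat \<Rightarrow> int. {(i, j). \<exists>p. run_with_period n s i j p}"
  \<comment> \<open>Initially every position is a class of its own, so the height is at most
    \<open>n + 6 * n + 2\<close>, which is at most \<open>9 * n\<close> for positive
    \<open>n\<close>.\<close>
  obtain T where T: "processes n T" "height T \<le> card (id ` {1..n}) + (6 * n + 2)"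
    "\<And>s s'. \<lbrakk>padded_word n s; padded_word n s'; path s T = path s' T\<rbrakk> \<Longrightarrow> ?G s = ?G s'"
  proof -
    have "s x = s y" if "id x = id y" for s :: "nat \<Rightarrow> int" and x y using that by simp
    from identifiable_imp_dtree[OF identifiable_runs, of n id, OF this]
    show ?thesis using that by blast
  qed
  \<comment> \<open>\<open>T\<close> was built for integer words, so one tree serves every alphabet
    and order through the ranks.\<close>
  have "finds_all_runs A r n T" if lin: "linear_order_on A r" for A :: "'a set" and r
    unfolding finds_all_runs_def
  proof (intro ballI impI)
    fix t1 t2 v i j
    assume t: "t1 \<in> strings A n" "t2 \<in> strings A n" and v: "v \<in> leaves T"
      and reach: "reaches r t1 T v \<and> reaches r t2 T v"
    have path: "v = path (rank_word r t) T" if "t \<in> strings A n" "reaches r t T v" for t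
      using that lin T(1) v by (intro path_eqI[of n r t]) (auto simp: strings_def intro!: compare_rank_word)
    have padded: "padded_word n (rank_word r t)" if "t \<in> strings A n" for t
      using padded_rank_word[OF lin, of t] that by (auto simp: strings_def)
    have runs: "is_run t i j \<longleftrightarrow> (i, j) \<in> ?G (rank_word r t)" if "t \<in> strings A n" for t
    proof -
      have len: "length t = n" "set t \<subseteq> A" using that by (auto simp: strings_def)
      have "char_at t x = char_at t y \<longleftrightarrow> rank_word r t x = rank_word r t y"
        if "x \<in> {1..n}" "y \<in> {1..n}" for x y
        using compare_rank_word[OF lin len(2), of x y] that len(1)
        by (auto simp: compare_in_def compare_int_def split: if_splits)
      then show ?thesis
        unfolding is_run_iff len(1) using run_with_period_cong by blast
    qed
    have "?G (rank_word r t1) = ?G (rank_word r t2)"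
      using T(3) padded path t reach by metis
    then show "is_run t1 i j \<longleftrightarrow> is_run t2 i j" using runs t by blast
  qed
  then show "\<exists>T. processes n T \<and> height T \<le> 9 * n \<and>
      (\<forall>(A::'a set) r. linear_order_on A r \<longrightarrow> finds_all_runs A r n T)"
    using T(1,2) n by (intro exI[of _ T]) auto
qed

end
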